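(* Let $T\ge 1$, $\mathbf{x}_1,\dots,\mathbf{x}_T\in\mathbb{R}^n$, $B\in\mathbb{R}$. Let $\mathbf{d}_1\in\mathcal{U}_1$ and $\mathbf{d}_t\in\mathcal{U}_t(\mathbf{d}_{t-1})$ for $t=2,\dots,T$, where $$\mathcal{U}_t(\mathbf{d}_{t-1})=\{\mathbf{d}_t\mid \mathbf{d}_t=\boldsymbol{\mu}_t+\mathbf{L}_t\mathbf{u}_t,\ \|\mathbf{u}_t\|_2\le r_t\},\qquad \mathbf{L}_t\mathbf{L}_t^\top=\boldsymbol{\Sigma}_t(\mathbf{d}_{t-1}),$$ the radii $r_t\ge 0$ and centers $\boldsymbol{\mu}_t$ are constants, $\boldsymbol{\Sigma}_1=\mathbf{L}_1\mathbf{L}_1^\top\succeq 0$ is a constant matrix, and for $t=1,\dots,T-1$ $$\boldsymbol{\Sigma}_{t+1}(\mathbf{d}_t)=a_t\,\boldsymbol{\Sigma}_t(\mathbf{d}_{t-1})+f_t\,(\mathbf{d}_t-\boldsymbol{\mu}_t)(\mathbf{d}_t-\boldsymbol{\mu}_t)^\top+\mathbf{C}_t$$ with constants $a_t\ge0$, $f_t\ge 0$, $\mathbf{C}_t\succeq 0$. Let $\mathcal{N}_{[1]}$ be the set of all sign families $\mathbf{n}_{[1]}=(n_{k,t})_{1\le k<t\le T}$ with $n_{k,t}\in\{1,-1\}$, and let $\mathbf{y}_t(\mathbf{n}_{[t]})$, $R_1=R_1(\mathbf{n}_{[1]})$ and $A_{k,t}$ be the quantities defined in the context. If $$\sum_{t=1}^T\boldsymbol{\mu}_t^\top\mathbf{x}_t+\sum_{t=1}^T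 r_t\sqrt{A_{1,t}}\;\|\mathbf{L}_1^\top\mathbf{y}_t(\mathbf{n}_{[t]})\|_2+R_1(\mathbf{n}_{[1]})\le B\qquad\text{for all }\mathbf{n}_{[1]}\in\mathcal{N}_{[1]},$$ then $$\sum_{t=1}^T\mathbf{d}_t^\top\mathbf{x}_t\le B\quad\text{for all }\mathbf{d}_1\in\mathcal{U}_1\text{ and all }\mathbf{d}_t\in\mathcal{U}_t(\mathbf{d}_{t-1}),\ t=2,\dots,T;$$ that is, the former system of inequalities is a conservative robust reformulation of the latter constraint.
   Context: All decisions $\mathbf{x}_t$ are here-and-now (fixed, not depending on the uncertainty). $\boldsymbol{\Sigma}_t(\mathbf{d}_{t-1})$ denotes the matrix obtained by running the recursion along the realized trajectory $\mathbf{d}_1,\dots,\mathbf{d}_{t-1}$. "Conservative reformulation" means that feasibility for the reformulation implies feasibility for the original robust constraint. For $1\le k\le t\le T$ let $A_{k,t}=\prod_{j=k}^{t-1}a_j$, with $A_{t,t}=1$. For a sign family $\mathbf{n}_{[1]}$, let $\mathbf{n}_{[k]}$ denote the subfamily $(n_{j,t})_{k\le j<t\le T}$. Define $\mathbf{y}_T=\mathbf{x}_T$ and, for $k=T-1,\dots,1$, $$\mathbf{y}_k(\mathbf{n}_{[k]})=\mathbf{x}_k+\sum_{t=k+1}^T n_{k,t}\,r_t\sqrt{A_{k+1,t}\,f_k}\;\mathbf{y}_t(\mathbf{n}_{[t]}).$$ Define $R_T=0$ and, for $k=T-1,\dots,1$, $$R_k=R_{k+1}+\sum_{t=k+1}^T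 r_t\sqrt{A_{k+1,t}\;\mathbf{y}_t(\mathbf{n}_{[t]})^\top\mathbf{C}_k\,\mathbf{y}_t(\mathbf{n}_{[t]})}.$$ *)

theory Defs
  imports "HOL-Analysis.Analysis"
begin

definition psd :: "real^'n^'n \<Rightarrow> bool" where
  "psd M \<longleftrightarrow> transpose M = M \<and> (\<forall>v. 0 \<le> v \<bullet> (M *v v))"

definition outer :: "real^'n \<Rightarrow> real^'n \<Rightarrow> real^'n^'n" where
  "outer v w = (\<chi> i j. v $ i * w $ j)"

definition uncertainty_set :: "real^'n \<Rightarrow> real^'n^'n \<Rightarrow> real \<Rightarrow> (real^'n) set" where
  "uncertainty_set \<mu> \<Sigma> r =
     {d. \<exists>(L :: real^'n^'n) u. L ** transpose L = \<Sigma> \<and> norm u \<le> r \<and> d = \<mu> + L *v u}"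

text \<open>
  The set does not depend on the choice of the factor: admitting every factor of \<open>\<Sigma>\<close>
  gives the same set as fixing one of them.
\<close>
lemma uncertainty_set_eq:
  fixes \<mu> :: "real^'n" and M :: "real^'n^'n"
  shows "uncertainty_set \<mu> (M ** transpose M) r = {d. \<exists>u. d = \<mu> + M *v u \<and> norm u \<le> r}"
proof -
  have norm_eq: "norm (transpose L *v v) = norm (transpose M *v v)"
    if "L ** transpose L = M ** transpose M" for L :: "real^'n^'n" and v
  proof -
    have quad: "(transpose K *v v) \<bullet> (transpose K *v v) = v \<bullet> ((K ** transpose K) *v v)"
      for K :: "real^'n^'n"
      by (metis dot_lmul_matrix matrix_vector_mul_assoc transpose_matrix_vector)
    show ?thesis
      unfolding norm_eq_sqrt_inner quad that ..
  qed
  have sub: "L *v u \<in> (\<lambda>w. M *v w) ` cball 0 r"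
    if eq: "L ** transpose L = M ** transpose M" and u: "norm u \<le> r" for L :: "real^'n^'n" and u
  proof (rule ccontr)
    let ?S = "(\<lambda>w. M *v w) ` cball 0 r"
    assume "L *v u \<notin> ?S"
    moreover have "convex ?S"
      by (intro convex_linear_image matrix_vector_mul_linear) simp
    moreover have "closed ?S"
      by (intro compact_imp_closed compact_continuous_image matrix_vector_mult_linear_continuous_on)
         simp
    ultimately obtain v b where v: "v \<bullet> (L *v u) < b" "\<forall>x\<in>?S. b < v \<bullet> x"
      using separating_hyperplane_closed_point by blast
    define p where "p = transpose M *v v"
    define w where "w = - (r / norm p) *\<^sub>R p"
    have r: "0 \<le> r" using u norm_ge_zero order_trans by blast
    have "norm w \<le> r"
      using r by (cases "p = 0") (simp_all add: w_def)
    then have "b < v \<bullet> (M *v w)"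
      using v(2) by auto
    also have "v \<bullet> (M *v w) = p \<bullet> w"
      by (simp add: p_def dot_lmul_matrix)
    also have "p \<bullet> w = - (r * norm p)"
      by (cases "p = 0") (simp_all add: w_def dot_square_norm power2_eq_square)
    also have "\<dots> \<le> - (norm u * norm p)"
      using u by (simp add: mult_right_mono)
    also have "\<dots> = - (norm (transpose L *v v) * norm u)"
      using norm_eq[OF eq, of v] by (simp add: p_def)
    also have "\<dots> \<le> (transpose L *v v) \<bullet> u"
      using Cauchy_Schwarz_ineq2[of "transpose L *v v" u] by linarith
    also have "\<dots> = v \<bullet> (L *v u)"
      by (simp add: dot_lmul_matrix)
    finally show False using v(1) by simp
  qed
  show ?thesis
  proof (intro subset_antisym subsetI)
    fix d assume "d \<in> uncertainty_set \<mu> (M ** transpose M) r"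
    then obtain L :: "real^'n^'n" and u where "L ** transpose L = M ** transpose M" "norm u \<le> r" "d = \<mu> + L *v u"
      unfolding uncertainty_set_def by blast
    then show "d \<in> {d. \<exists>u. d = \<mu> + M *v u \<and> norm u \<le> r}"
      using sub[of L u] by auto
  next
    fix d assume "d \<in> {d. \<exists>u. d = \<mu> + M *v u \<and> norm u \<le> r}"
    then show "d \<in> uncertainty_set \<mu> (M ** transpose M) r"
      unfolding uncertainty_set_def by blast
  qed
qed

text \<open>
  All time-indexed families are functions on \<^typ>\<open>nat\<close> of which only the entries
  \<open>1, \<dots>, T\<close> matter. The value of \<open>cov\<close> at \<open>0\<close> is a dummy; \<open>cov \<dots> t\<close> only depends on
  \<open>d 1, \<dots>, d (t - 1)\<close>.
\<close>
fun cov :: "real^'n^'n \<Rightarrow> (nat \<Rightarrow> real) \<Rightarrow> (nat \<Rightarrow> real) \<Rightarrow> (nat \<Rightarrow> real^'n^'n) \<Rightarrow>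
    (nat \<Rightarrow> real^'n) \<Rightarrow> (nat \<Rightarrow> real^'n) \<Rightarrow> nat \<Rightarrow> real^'n^'n" where
  "cov \<Sigma>1 a f C \<mu> d 0 = \<Sigma>1"
| "cov \<Sigma>1 a f C \<mu> d (Suc 0) = \<Sigma>1"
| "cov \<Sigma>1 a f C \<mu> d (Suc (Suc t)) =
     a (Suc t) *\<^sub>R cov \<Sigma>1 a f C \<mu> d (Suc t)
     + f (Suc t) *\<^sub>R outer (d (Suc t) - \<mu> (Suc t)) (d (Suc t) - \<mu> (Suc t))
     + C (Suc t)"

definition sign_families :: "nat \<Rightarrow> (nat \<times> nat \<Rightarrow> real) set" where
  "sign_families T = (\<Pi>\<^sub>E kt \<in> {(k, t). 1 \<le> k \<and> k < t \<and> t \<le> T}. {1, -1})"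

definition aprod :: "(nat \<Rightarrow> real) \<Rightarrow> nat \<Rightarrow> nat \<Rightarrow> real" where
  "aprod a k t = (\<Prod>j = k..<t. a j)"

text \<open>
  The whole sign family is passed to \<open>ycomb\<close>, but \<open>ycomb \<dots> n k\<close> only reads the entries
  \<open>n (j, t)\<close> with \<open>k \<le> j < t \<le> T\<close>.
\<close>
function ycomb :: "nat \<Rightarrow> (nat \<Rightarrow> real) \<Rightarrow> (nat \<Rightarrow> real) \<Rightarrow> (nat \<Rightarrow> real) \<Rightarrow>
    (nat \<Rightarrow> real^'n) \<Rightarrow> (nat \<times> nat \<Rightarrow> real) \<Rightarrow> nat \<Rightarrow> real^'n" where
  "ycomb T r a f x n k =
     (if k < T
      then x k + (\<Sum>t = Suc k..T. (n (k, t) * r t * sqrt (aprod a (Suc k) t * f k)) *\<^sub>R ycomb T r a f x n t)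
      else x k)"
  by pat_completeness auto
termination
  by (relation "Wellfounded.measure (\<lambda>(T, r, a, f, x, n, k). T - k)") auto

declare ycomb.simps [simp del]

function Rsum :: "nat \<Rightarrow> (nat \<Rightarrow> real) \<Rightarrow> (nat \<Rightarrow> real) \<Rightarrow> (nat \<Rightarrow> real) \<Rightarrow> (nat \<Rightarrow> real^'n^'n) \<Rightarrow>
    (nat \<Rightarrow> real^'n) \<Rightarrow> (nat \<times> nat \<Rightarrow> real) \<Rightarrow> nat \<Rightarrow> real" where
  "Rsum T r a f C x n k =
     (if k < T
      then Rsum T r a f C x n (Suc k)
           + (\<Sum>t = Suc k..T.
                r t * sqrt (aprod a (Suc k) t * (ycomb T r a f x n t \<bullet> (C k *v ycomb T r a f x n t))))
      else 0)"
  by pat_completeness auto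
termination
  by (relation "Wellfounded.measure (\<lambda>(T, r, a, f, C, x, n, k). T - k)") auto

declare Rsum.simps [simp del]

end

theory Submission
  imports Defs
begin

text \<open>
  Write \<open>z t = d t - \<mu> t\<close>. For a fixed trajectory, a single sign family suffices: choose
  \<open>n (k, t)\<close> as the sign of \<open>z k \<bullet> y t\<close>, backwards in \<open>k\<close>, which is possible since \<open>y t\<close>
  only reads signs with first index at least \<open>t > k\<close>. Then one shows, backwards in \<open>k\<close>, that
  \<open>(\<Sum>t = k..T. z t \<bullet> x t) \<le> (\<Sum>t = k..T. r t * sqrt (A k t * (y t \<bullet> (\<Sigma> k *v y t)))) + R k\<close>.
  In the step, subadditivity of the square root splits the three summands of \<open>\<Sigma> (k + 1)\<close>; the
  rank-one parts \<open>\<bar>z k \<bullet> y t\<bar>\<close> combine with \<open>z k \<bullet> x k\<close> to \<open>z k \<bullet> y k\<close>, and the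
  Cauchy-Schwarz inequality bounds this by \<open>r k * sqrt (y k \<bullet> (\<Sigma> k *v y k))\<close>.
\<close>

lemma inner_mult_transpose:
  fixes L :: "real^'n^'n"
  shows "v \<bullet> ((L ** transpose L) *v v) = (norm (transpose L *v v))\<^sup>2"
  unfolding power2_norm_eq_inner
  by (metis dot_lmul_matrix matrix_vector_mul_assoc transpose_matrix_vector)

lemma inner_outer: "v \<bullet> (outer z z *v v) = (z \<bullet> v)\<^sup>2"
  for v z :: "real^'n"
  by (simp add: outer_def inner_vec_def matrix_vector_mult_def power2_eq_square sum_product
      sum_distrib_left sum_distrib_right mult_ac)

text \<open>A point of the set brings a factor \<open>L\<close> with
  \<open>L ** transpose L = S\<close>, so the quadratic form is a squared norm. Along a realized
  trajectory this makes every covariance semidefinite without an induction over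
  \<open>cov\<close>.\<close>

lemma uncertainty_set_inner_nonneg:
  assumes "d \<in> uncertainty_set \<mu> S r"
  shows "0 \<le> v \<bullet> (S *v v)"
  using assms inner_mult_transpose[of v] unfolding uncertainty_set_def by force

text \<open>Moving \<open>L\<close> to the other side of the inner product leaves
  \<open>transpose L *v v\<close>, whose norm depends on \<open>S\<close> alone; Cauchy-Schwarz does
  the rest.\<close>

lemma uncertainty_set_inner_le:
  fixes d :: "real^'n"
  assumes "d \<in> uncertainty_set \<mu> S r"
  shows "(d - \<mu>) \<bullet> v \<le> r * sqrt (v \<bullet> (S *v v))"
proof -
  obtain L :: "real^'n^'n" and u where L: "L ** transpose L = S" "norm u \<le> r" "d = \<mu> + L *v u"
    using assms unfolding uncertainty_set_def by blast
  have "(d - \<mu>) \<bullet> v = (transpose L *v v) \<bullet> u"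
    using L(3) by (simp add: dot_lmul_matrix inner_commute[of _ v])
  also have "\<dots> \<le> norm (transpose L *v v) * norm u"
    by (rule norm_cauchy_schwarz)
  also have "\<dots> \<le> norm (transpose L *v v) * r"
    using L(2) by (simp add: mult_left_mono)
  also have "\<dots> = r * sqrt (v \<bullet> (S *v v))"
    using inner_mult_transpose[of v L] L(1) by simp
  finally show ?thesis .
qed

lemma inner_cov_Suc:
  assumes "1 \<le> k"
  shows "v \<bullet> (cov S a f C \<mu> d (Suc k) *v v) =
    a k * (v \<bullet> (cov S a f C \<mu> d k *v v)) + f k * ((d k - \<mu> k) \<bullet> v)\<^sup>2 + v \<bullet> (C k *v v)"
proof -
  obtain j where "k = Suc j" using assms by (cases k) auto
  then show ?thesis
    by (simp add: matrix_vector_mult_add_rdistrib inner_add_right inner_outer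
        scaleR_matrix_vector_assoc[symmetric])
qed

lemma aprod_nonneg:
  assumes "\<And>j. k \<le> j \<Longrightarrow> j < t \<Longrightarrow> 0 \<le> a j"
  shows "0 \<le> aprod a k t"
  unfolding aprod_def by (rule prod_nonneg) (use assms in auto)

lemma aprod_Suc: "k < t \<Longrightarrow> aprod a k t = a k * aprod a (Suc k) t"
  unfolding aprod_def by (rule prod.atLeast_Suc_lessThan)

text \<open>This lets the signs with first index \<open>m\<close> be changed while every
  \<open>ycomb\<close> at a later index stays fixed.\<close>

lemma ycomb_cong:
  assumes "\<And>j t. k \<le> j \<Longrightarrow> j < t \<Longrightarrow> t \<le> T \<Longrightarrow> n (j, t) = n' (j, t)"
  shows "ycomb T r a f x n k = ycomb T r a f x n' k"
  using assms
proof (induction "T - k" arbitrary: k rule: less_induct)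
  case less
  have "ycomb T r a f x n t = ycomb T r a f x n' t" if "t \<in> {Suc k..T}" "k < T" for t
    by (rule less.hyps) (use that less.prems in auto)
  then show ?case
    using less.prems by (subst (1 2) ycomb.simps) (auto intro!: sum.cong)
qed

lemma exists_sign_family_abs:
  fixes z :: "nat \<Rightarrow> real^'n"
  assumes "1 \<le> T"
  shows "\<exists>n \<in> sign_families T. \<forall>k t. 1 \<le> k \<longrightarrow> k < t \<longrightarrow> t \<le> T \<longrightarrow>
    n (k, t) * (z k \<bullet> ycomb T r a f x n t) = \<bar>z k \<bullet> ycomb T r a f x n t\<bar>"
  using assms
proof (induction rule: inc_induct)
  case base
  \<comment> \<open>No pair satisfies T \<le> k < t \<le> T, so any family serves as a
    start.\<close>
  have "(\<lambda>kt \<in> {(k, t). 1 \<le> k \<and> k < t \<and> t \<le> T}. 1) \<in> sign_families T"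
    unfolding sign_families_def by auto
  then show ?case by (intro bexI) auto
next
  case (step m)
  then obtain n where n: "n \<in> sign_families T"
    "\<And>k t. Suc m \<le> k \<Longrightarrow> k < t \<Longrightarrow> t \<le> T \<Longrightarrow>
      n (k, t) * (z k \<bullet> ycomb T r a f x n t) = \<bar>z k \<bullet> ycomb T r a f x n t\<bar>"
    by blast
  \<comment> \<open>Only row \<open>m\<close> is overwritten. Its signs are read off from the old
    \<open>n\<close>, which is not circular because the vectors involved have index t > m.\<close>
  define n' where "n' = (\<lambda>(k, t). if k = m \<and> m < t \<and> t \<le> T
    then (if 0 \<le> z m \<bullet> ycomb T r a f x n t then 1 else -1) else n (k, t))"
  have y: "ycomb T r a f x n' t = ycomb T r a f x n t" if "m < t" for t
    by (rule ycomb_cong) (use that in \<open>auto simp: n'_def\<close>)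
  have "n' \<in> sign_families T"
    using n(1) step.hyps unfolding sign_families_def n'_def
    by (auto simp: PiE_iff extensional_def)
  moreover have "n' (k, t) * (z k \<bullet> ycomb T r a f x n' t) = \<bar>z k \<bullet> ycomb T r a f x n' t\<bar>"
    if "m \<le> k" "k < t" "t \<le> T" for k t
    using that n(2)[of k t] y[of t] by (cases "k = m") (auto simp: n'_def)
  ultimately show ?case by blast
qed

lemma sqrt_add3_le:
  assumes "0 \<le> p" "0 \<le> q" "0 \<le> s"
  shows "sqrt (p + q + s) \<le> sqrt p + sqrt q + sqrt s"
  using sqrt_add_le_add_sqrt[of "p + q" s] sqrt_add_le_add_sqrt[of p q] assms by linarith

lemma sum_deviation_le:
  fixes x \<mu> d :: "nat \<Rightarrow> real^'n" and C :: "nat \<Rightarrow> real^'n^'n"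
    and r a f :: "nat \<Rightarrow> real" and S1 T n
  defines "S \<equiv> cov S1 a f C \<mu> d" and "y \<equiv> ycomb T r a f x n"
  assumes "1 \<le> k" "k \<le> T"
    and r: "\<And>t. t \<in> {1..T} \<Longrightarrow> 0 \<le> r t"
    and a: "\<And>t. t \<in> {1..<T} \<Longrightarrow> 0 \<le> a t"
    and f: "\<And>t. t \<in> {1..<T} \<Longrightarrow> 0 \<le> f t"
    and C: "\<And>t. t \<in> {1..<T} \<Longrightarrow> psd (C t)"
    and d: "\<And>t. t \<in> {1..T} \<Longrightarrow> d t \<in> uncertainty_set (\<mu> t) (S t) (r t)"
    and n: "\<And>k t. 1 \<le> k \<Longrightarrow> k < t \<Longrightarrow> t \<le> T \<Longrightarrow>
      n (k, t) * ((d k - \<mu> k) \<bullet> y t) = \<bar>(d k - \<mu> k) \<bullet> y t\<bar>"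
  shows "(\<Sum>t = k..T. (d t - \<mu> t) \<bullet> x t) \<le>
    (\<Sum>t = k..T. r t * sqrt (aprod a k t * (y t \<bullet> (S k *v y t)))) + Rsum T r a f C x n k"
  using \<open>k \<le> T\<close>
proof (induction rule: inc_induct)
  case base
  have "y T = x T" unfolding y_def by (subst ycomb.simps) simp
  moreover have "Rsum T r a f C x n T = 0" by (subst Rsum.simps) simp
  moreover have "d T \<in> uncertainty_set (\<mu> T) (S T) (r T)"
    using d \<open>1 \<le> k\<close> \<open>k \<le> T\<close> by simp
  ultimately show ?case
    using uncertainty_set_inner_le[of "d T" "\<mu> T" "S T" "r T" "x T"] by (simp add: aprod_def)
next
  case (step m)
  have m: "1 \<le> m" "m < T" using step.hyps \<open>1 \<le> k\<close> by auto
  have d_m: "d m \<in> uncertainty_set (\<mu> m) (S m) (r m)" using d m by simp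
  define z where "z = d m - \<mu> m"
  define A where "A t = aprod a (Suc m) t" for t
  \<comment> \<open>\<open>g\<close>, \<open>h\<close> and \<open>c\<close> are the shares of the
    scaled old covariance, the rank-one update and \<open>C m\<close> in the bound at
    \<open>Suc m\<close>.\<close>
  define g where "g t = r t * sqrt (aprod a m t * (y t \<bullet> (S m *v y t)))" for t
  define h where "h t = r t * sqrt (A t * f m) * \<bar>z \<bullet> y t\<bar>" for t
  define c where "c t = r t * sqrt (A t * (y t \<bullet> (C m *v y t)))" for t
  have term_le: "r t * sqrt (A t * (y t \<bullet> (S (Suc m) *v y t))) \<le> g t + h t + c t"
    if t: "t \<in> {Suc m..T}" for t
  proof -
    have A: "0 \<le> A t"
      unfolding A_def by (rule aprod_nonneg) (use a m t in auto)
    have "0 \<le> y t \<bullet> (S m *v y t)"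
      by (rule uncertainty_set_inner_nonneg[OF d_m])
    then have 1: "0 \<le> aprod a m t * (y t \<bullet> (S m *v y t))"
      using a m t by (intro mult_nonneg_nonneg aprod_nonneg) auto
    have 2: "0 \<le> A t * f m * (z \<bullet> y t)\<^sup>2"
      using A f m by simp
    have 3: "0 \<le> A t * (y t \<bullet> (C m *v y t))"
      using A C m by (simp add: psd_def)
    \<comment> \<open>The factor \<open>a m\<close> of the recursion extends the product
      \<open>A t\<close> downwards to \<open>aprod a m t\<close>.\<close>
    have "A t * (y t \<bullet> (S (Suc m) *v y t)) =
        aprod a m t * (y t \<bullet> (S m *v y t)) + A t * f m * (z \<bullet> y t)\<^sup>2 + A t * (y t \<bullet> (C m *v y t))"
      using t unfolding S_def inner_cov_Suc[OF m(1)] by (simp add: A_def z_def aprod_Suc algebra_simps)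
    then have "sqrt (A t * (y t \<bullet> (S (Suc m) *v y t))) \<le>
        sqrt (aprod a m t * (y t \<bullet> (S m *v y t))) + sqrt (A t * f m) * \<bar>z \<bullet> y t\<bar>
        + sqrt (A t * (y t \<bullet> (C m *v y t)))"
      using sqrt_add3_le[OF 1 2 3] by (simp add: real_sqrt_mult)
    moreover have "0 \<le> r t" using r t by simp
    ultimately show ?thesis
      unfolding g_def h_def c_def
      by (metis (no_types, lifting) distrib_left mult.assoc mult_left_mono)
  qed
  have y_m: "y m = x m + (\<Sum>t = Suc m..T. (n (m, t) * r t * sqrt (A t * f m)) *\<^sub>R y t)"
    unfolding y_def A_def by (subst ycomb.simps) (use m in simp)
  \<comment> \<open>The weights in \<open>y m\<close> are those of \<open>h\<close>, so the chosen
    signs turn its pairing with \<open>z\<close> into \<open>z \<bullet> x m\<close> plus all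
    rank-one shares.\<close>
  have "z \<bullet> y m = z \<bullet> x m + (\<Sum>t = Suc m..T. n (m, t) * r t * sqrt (A t * f m) * (z \<bullet> y t))"
    unfolding y_m by (simp add: inner_add_right inner_sum_right)
  also have "(\<Sum>t = Suc m..T. n (m, t) * r t * sqrt (A t * f m) * (z \<bullet> y t)) = (\<Sum>t = Suc m..T. h t)"
  proof (rule sum.cong)
    fix t assume "t \<in> {Suc m..T}"
    then have "n (m, t) * (z \<bullet> y t) = \<bar>z \<bullet> y t\<bar>"
      unfolding z_def using n[OF m(1)] by simp
    then show "n (m, t) * r t * sqrt (A t * f m) * (z \<bullet> y t) = h t"
      unfolding h_def by (metis mult.assoc mult.commute)
  qed simp
  finally have zy: "z \<bullet> x m + (\<Sum>t = Suc m..T. h t) = z \<bullet> y m" by simp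
  \<comment> \<open>Since \<open>aprod a m m\<close> is the empty product 1, the Cauchy-Schwarz
    bound is exactly the term of the \<open>g\<close> sum still missing at t = m.\<close>
  have "z \<bullet> y m \<le> g m"
    unfolding z_def g_def using uncertainty_set_inner_le[OF d_m] by (simp add: aprod_def)
  moreover have "Rsum T r a f C x n m = Rsum T r a f C x n (Suc m) + (\<Sum>t = Suc m..T. c t)"
    unfolding c_def A_def y_def by (subst Rsum.simps) (use m in simp)
  moreover have "(\<Sum>t = m..T. (d t - \<mu> t) \<bullet> x t) = z \<bullet> x m + (\<Sum>t = Suc m..T. (d t - \<mu> t) \<bullet> x t)"
    unfolding z_def using m by (intro sum.atLeast_Suc_atMost) simp
  moreover have "(\<Sum>t = m..T. g t) = g m + (\<Sum>t = Suc m..T. g t)"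
    using m by (intro sum.atLeast_Suc_atMost) simp
  moreover have "(\<Sum>t = Suc m..T. r t * sqrt (A t * (y t \<bullet> (S (Suc m) *v y t)))) \<le>
      (\<Sum>t = Suc m..T. g t) + (\<Sum>t = Suc m..T. h t) + (\<Sum>t = Suc m..T. c t)"
    using sum_mono[of "{Suc m..T}", OF term_le] by (simp add: sum.distrib)
  ultimately show ?case
    using step.IH zy unfolding g_def[symmetric] A_def by linarith
qed

theorem theorem2:
  fixes T :: nat
    and x \<mu> :: "nat \<Rightarrow> real^'n"
    and B :: real
    and r a f :: "nat \<Rightarrow> real"
    and C :: "nat \<Rightarrow> real^'n^'n"
    and L1 \<Sigma>1 :: "real^'n^'n"
  assumes "1 \<le> T"
    and "\<And>t. t \<in> {1..T} \<Longrightarrow> 0 \<le> r t"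
    and "\<And>t. t \<in> {1..<T} \<Longrightarrow> 0 \<le> a t"
    and "\<And>t. t \<in> {1..<T} \<Longrightarrow> 0 \<le> f t"
    and "\<And>t. t \<in> {1..<T} \<Longrightarrow> psd (C t)"
    and "\<Sigma>1 = L1 ** transpose L1" and "psd \<Sigma>1"
    and "\<forall>n \<in> sign_families T.
           (\<Sum>t = 1..T. \<mu> t \<bullet> x t)
           + (\<Sum>t = 1..T. r t * sqrt (aprod a 1 t) * norm (transpose L1 *v ycomb T r a f x n t))
           + Rsum T r a f C x n 1 \<le> B"
  shows "\<forall>d. d 1 \<in> uncertainty_set (\<mu> 1) \<Sigma>1 (r 1)
           \<and> (\<forall>t \<in> {2..T}. d t \<in> uncertainty_set (\<mu> t) (cov \<Sigma>1 a f C \<mu> d t) (r t))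
           \<longrightarrow> (\<Sum>t = 1..T. d t \<bullet> x t) \<le> B"
proof (intro allI impI)
  fix d
  assume asm: "d 1 \<in> uncertainty_set (\<mu> 1) \<Sigma>1 (r 1)
    \<and> (\<forall>t \<in> {2..T}. d t \<in> uncertainty_set (\<mu> t) (cov \<Sigma>1 a f C \<mu> d t) (r t))"
  have d: "d t \<in> uncertainty_set (\<mu> t) (cov \<Sigma>1 a f C \<mu> d t) (r t)" if "t \<in> {1..T}" for t
    using asm that by (cases "t = 1") auto
  \<comment> \<open>The family depends on \<open>d\<close>, which is why the assumed inequality
    ranges over all sign families.\<close>
  obtain n where n: "n \<in> sign_families T"
    "\<And>k t. 1 \<le> k \<Longrightarrow> k < t \<Longrightarrow> t \<le> T \<Longrightarrow>
      n (k, t) * ((d k - \<mu> k) \<bullet> ycomb T r a f x n t) = \<bar>(d k - \<mu> k) \<bullet> ycomb T r a f x n t\<bar>"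
    using exists_sign_family_abs[OF assms(1), of "\<lambda>k. d k - \<mu> k" r a f x] by blast
  have "(\<Sum>t = 1..T. d t \<bullet> x t) = (\<Sum>t = 1..T. \<mu> t \<bullet> x t) + (\<Sum>t = 1..T. (d t - \<mu> t) \<bullet> x t)"
    by (simp add: inner_diff_left sum_subtractf)
  moreover have "(\<Sum>t = 1..T. (d t - \<mu> t) \<bullet> x t) \<le>
      (\<Sum>t = 1..T. r t * sqrt (aprod a 1 t *
        (ycomb T r a f x n t \<bullet> (cov \<Sigma>1 a f C \<mu> d 1 *v ycomb T r a f x n t))))
      + Rsum T r a f C x n 1"
    by (rule sum_deviation_le[OF _ assms(1-5) d n(2)]) auto
  \<comment> \<open>The first covariance is \<open>L1 ** transpose L1\<close>, so the root of its
    quadratic form is the norm in the reformulation.\<close>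
  moreover have "(\<Sum>t = 1..T. r t * sqrt (aprod a 1 t *
        (ycomb T r a f x n t \<bullet> (cov \<Sigma>1 a f C \<mu> d 1 *v ycomb T r a f x n t)))) =
      (\<Sum>t = 1..T. r t * sqrt (aprod a 1 t) * norm (transpose L1 *v ycomb T r a f x n t))"
    unfolding One_nat_def cov.simps assms(6) inner_mult_transpose
    by (simp add: real_sqrt_mult mult.assoc)
  ultimately show "(\<Sum>t = 1..T. d t \<bullet> x t) \<le> B"
    using bspec[OF assms(8) n(1)] by linarith
qed

end
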